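(* Let $\mathcal{N}=\{1,\dots,n\}$ be a universe of products with preference weights $v_1\ge\cdots\ge v_n>0$, and let $T\ge1$ be the number of customers. There exists a static weight-ordered assortment that provides a $1/4$-approximation to the dynamic maximum load assortment problem, i.e. $$\mathrm{OPT}^{\mathrm{WO}}(\mathcal{N})\ \ge\ \frac14\cdot\mathrm{OPT}^{\mathrm{DP}}(\mathcal{N}).$$
   Context: Multinomial Logit (MNL) model: each product $i\in\mathcal{N}$ has preference weight $v_i>0$ and the no-purchase option $0$ has weight $1$. For an assortment $S\subseteq\mathcal{N}$ let $v(S)=\sum_{i\in S}v_i$, $\phi_i(S)=\frac{v_i}{1+v(S)}$ for $i\in S$, and $\phi_0(S)=\frac{1}{1+v(S)}$. Static setting: when $S$ is offered to all $T$ customers, each customer independently chooses option $i\in S\cup\{0\}$ with probability $\phi_i(S)$; $L_i(S)$ is the number of customers choosing product $i$ and $M(S)=\max_{i\in S}L_i(S)$. Define $\mathrm{OPT}^{\mathrm{WO}}(\mathcal{N})=\max_{1\le m\le n}\mathbb{E}(M(\{1,\dots,m\}))$, the best expected maximum load of a static weight-ordered assortment, i.e. one of the form $\{1,\dots,m\}$. Dynamic setting: customers arrive one by one, and the assortment offered to each customer may depend on the current load vector $\boldsymbol\ell\in\mathbb{Z}_{\ge0}^n$ (the number of previous customers who chose each product) and on the number of remaining customers; a customer offered $S$ chooses $i\in S\cup\{0\}$ with probability $\phi_i(S)$. Let $\mathcal{M}_0(\boldsymbol\ell)=\max_i\ell_i$ and $$\mathcal{M}_t(\boldsymbol\ell)=\max_{S\subseteq\mathcal{N}}\Big(\mathcal{M}_{t-1}(\boldsymbol\ell)\,\phi_0(S)+\sum_{i\in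 S}\mathcal{M}_{t-1}(\boldsymbol\ell+\mathbf{e}_i)\,\phi_i(S)\Big),$$ where $\mathbf{e}_i$ is the $i$-th unit vector. Then $\mathrm{OPT}^{\mathrm{DP}}(\mathcal{N})=\mathcal{M}_T(\mathbf{0})$ is the optimal expected maximum load of an adaptive policy. *)

theory Defs
  imports "HOL-Probability.Probability"
begin

text \<open>Products are the natural numbers \<open>1, \<dots>, n\<close>; option \<open>0\<close> is the no-purchase option.
  Assortments are sets of products, so they never contain \<open>0\<close>.\<close>

definition total_weight :: "(nat \<Rightarrow> real) \<Rightarrow> nat set \<Rightarrow> real" where
  "total_weight v S = (\<Sum>i\<in>S. v i)"

definition mnl_prob :: "(nat \<Rightarrow> real) \<Rightarrow> nat set \<Rightarrow> nat \<Rightarrow> real" where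
  "mnl_prob v S i =
     (if i = 0 then 1 / (1 + total_weight v S)
      else if i \<in> S then v i / (1 + total_weight v S)
      else 0)"

definition mnl_pmf :: "(nat \<Rightarrow> real) \<Rightarrow> nat set \<Rightarrow> nat pmf" where
  "mnl_pmf v S = embed_pmf (mnl_prob v S)"

text \<open>The use of \<^const>\<open>embed_pmf\<close> is justified for all assortments of positive-weight products:\<close>

lemma pmf_mnl_pmf:
  assumes "finite S" "0 \<notin> S" "\<And>i. i \<in> S \<Longrightarrow> v i > 0"
  shows "pmf (mnl_pmf v S) i = mnl_prob v S i"
proof -
  have w: "total_weight v S \<ge> 0"
    unfolding total_weight_def using assms(3) by (intro sum_nonneg) (auto intro: less_imp_le)
  have nn: "mnl_prob v S j \<ge> 0" for j
    using w assms(3)[of j] by (auto simp: mnl_prob_def intro!: divide_nonneg_nonneg less_imp_le)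
  have "(\<Sum>j\<in>S. mnl_prob v S j) = (\<Sum>j\<in>S. v j / (1 + total_weight v S))"
    using assms(2) by (intro sum.cong) (auto simp: mnl_prob_def)
  also have "\<dots> = total_weight v S / (1 + total_weight v S)"
    by (simp add: total_weight_def sum_divide_distrib)
  finally have "(\<Sum>j\<in>insert 0 S. mnl_prob v S j) = 1"
    using assms(1,2) w by (simp add: mnl_prob_def[of v S 0] add_divide_distrib[symmetric])
  moreover have "(\<integral>\<^sup>+ j. ennreal (mnl_prob v S j) \<partial>count_space UNIV)
      = (\<Sum>j\<in>insert 0 S. ennreal (mnl_prob v S j))"
    using assms(1) by (intro nn_integral_count_space'[where A = "insert 0 S"])
      (auto simp: mnl_prob_def)
  ultimately have "(\<integral>\<^sup>+ j. ennreal (mnl_prob v S j) \<partial>count_space UNIV) = 1"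
    using nn by (simp only: sum_ennreal ennreal_1)
  then show ?thesis
    unfolding mnl_pmf_def using nn by (intro pmf_embed_pmf) auto
qed

text \<open>\<open>\<omega> t\<close> is the option chosen by customer \<open>t < T\<close>; the customers choose independently.\<close>

definition static_choices :: "(nat \<Rightarrow> real) \<Rightarrow> nat \<Rightarrow> nat set \<Rightarrow> (nat \<Rightarrow> nat) pmf" where
  "static_choices v T S = Pi_pmf {..<T} 0 (\<lambda>_. mnl_pmf v S)"

definition load :: "nat \<Rightarrow> (nat \<Rightarrow> nat) \<Rightarrow> nat \<Rightarrow> nat" where
  "load T \<omega> i = card {t \<in> {..<T}. \<omega> t = i}"

definition max_load :: "nat \<Rightarrow> nat set \<Rightarrow> (nat \<Rightarrow> nat) \<Rightarrow> nat" where
  "max_load T S \<omega> = (MAX i\<in>S. load T \<omega> i)"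

definition expected_max_load :: "(nat \<Rightarrow> real) \<Rightarrow> nat \<Rightarrow> nat set \<Rightarrow> real" where
  "expected_max_load v T S =
     measure_pmf.expectation (static_choices v T S) (\<lambda>\<omega>. real (max_load T S \<omega>))"

definition OPT_WO :: "(nat \<Rightarrow> real) \<Rightarrow> nat \<Rightarrow> nat \<Rightarrow> real" where
  "OPT_WO v n T = (MAX m\<in>{1..n}. expected_max_load v T {1..m})"

primrec dp_value :: "(nat \<Rightarrow> real) \<Rightarrow> nat \<Rightarrow> nat \<Rightarrow> (nat \<Rightarrow> nat) \<Rightarrow> real" where
  "dp_value v n 0 l = real (MAX i\<in>{1..n}. l i)"
| "dp_value v n (Suc t) l =
     (MAX S\<in>Pow {1..n}.
        dp_value v n t l * mnl_prob v S 0
        + (\<Sum>i\<in>S. dp_value v n t (l(i := l i + 1)) * mnl_prob v S i))"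

definition OPT_DP :: "(nat \<Rightarrow> real) \<Rightarrow> nat \<Rightarrow> nat \<Rightarrow> real" where
  "OPT_DP v n T = dp_value v n T (\<lambda>_. 0)"

end

theory Submission
  imports Defs
begin

text \<open>
  The weights are split at the largest \<open>m\<close> with \<open>v 1 + \<dots> + v m \<le> 1\<close>.  The maximum load of an
  adaptive policy is at most its maximum load over the heavy products \<open>{1..m}\<close> plus its maximum
  load over the light products \<open>{m+1..n}\<close>, and each of the two terms is at most twice what a
  single static weight-ordered assortment earns, \<open>{1..m}\<close> for the first and \<open>{1..m+1}\<close> for the
  second.

  Heavy products.  Whatever is offered, product \<open>i\<close> is chosen with probability at most \<open>v i\<close>.
  Since these bounds sum to at most \<open>1\<close> over the heavy products, they form a static choice
  distribution, which dominates the policy product by product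
  (\<open>adaptive_value_le_static_value_pointwise\<close>).  The assortment \<open>{1..m}\<close> realises this
  distribution with all probabilities divided by \<open>1 + v 1 + \<dots> + v m \<le> 2\<close>.

  Light products.  Now \<open>w = v (m+1)\<close> is the largest light weight, so each light product is chosen with
  probability at most \<open>c = w / (1 + w)\<close>.  The distribution \<open>q\<close> on \<open>{1..m+1}\<close> proportional to the
  weights gives every product at least \<open>c\<close>: all weights there are at least \<open>w\<close>, and they sum to
  at most \<open>1 + w\<close>.  A static process whose \<open>m+1\<close> products each receive at least \<open>c\<close> and which
  always sells is more concentrated than any policy that gives each product at most \<open>c\<close>, however
  many products the policy uses: its load vector stays above that of the policy in the weak
  majorization order (\<open>adaptive_value_le_static_value_majorized\<close>).  The assortment \<open>{1..m+1}\<close>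
  realises \<open>q\<close> with all probabilities multiplied by \<open>W / (1 + W)\<close>, where \<open>W\<close> is its total weight;
  the factor is at least \<open>1/2\<close> because \<open>W > 1\<close> by maximality of \<open>m\<close>.

  Multiplying all choice probabilities by \<open>a \<le> 1\<close> retains at least the fraction \<open>a\<close> of the expected
  maximum load (\<open>static_value_thinning\<close>), so each part contributes at most \<open>2 OPT_WO\<close>.
\<close>

section \<open>Recursive values of static and adaptive processes\<close>

text \<open>The extra \<open>0\<close> gives the empty set of products the peak \<open>0\<close>, which lets one of the two groups
  of products be empty.\<close>

definition peak :: "nat set \<Rightarrow> (nat \<Rightarrow> real) \<Rightarrow> real" where
  "peak I z = Max (insert 0 (z ` I))"

text \<open>Expected final peak over \<open>I\<close> when each of \<open>t\<close> customers raises the load of \<open>i \<in> I\<close> with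
  probability \<open>p i\<close> and otherwise does nothing.  The loads \<open>z\<close> are real rather than natural so
  that convexity in \<open>z\<close> makes sense.\<close>

primrec static_value :: "(nat \<Rightarrow> real) \<Rightarrow> nat set \<Rightarrow> nat \<Rightarrow> (nat \<Rightarrow> real) \<Rightarrow> real" where
  "static_value p I 0 z = peak I z"
| "static_value p I (Suc t) z =
     (1 - (\<Sum>i\<in>I. p i)) * static_value p I t z
     + (\<Sum>i\<in>I. p i * static_value p I t (z(i := z i + 1)))"

text \<open>The dynamic program with an arbitrary terminal reward \<open>g\<close>, so that the peaks over two groups
  of products can be optimised separately.\<close>

primrec adaptive_value ::
  "(nat \<Rightarrow> real) \<Rightarrow> nat \<Rightarrow> ((nat \<Rightarrow> nat) \<Rightarrow> real) \<Rightarrow> nat \<Rightarrow> (nat \<Rightarrow> nat) \<Rightarrow> real" where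
  "adaptive_value v n g 0 l = g l"
| "adaptive_value v n g (Suc t) l =
     (MAX S\<in>Pow {1..n}.
        adaptive_value v n g t l * mnl_prob v S 0
        + (\<Sum>i\<in>S. adaptive_value v n g t (l(i := l i + 1)) * mnl_prob v S i))"

lemma peak_le_iff: "finite I \<Longrightarrow> peak I z \<le> b \<longleftrightarrow> 0 \<le> b \<and> (\<forall>i\<in>I. z i \<le> b)"
  unfolding peak_def by auto

lemma peak_ge: "finite I \<Longrightarrow> i \<in> I \<Longrightarrow> z i \<le> peak I z"
  unfolding peak_def by auto

lemma peak_nonneg: "finite I \<Longrightarrow> 0 \<le> peak I z"
  unfolding peak_def by auto

lemma peak_cong: "(\<And>i. i \<in> I \<Longrightarrow> z i = z' i) \<Longrightarrow> peak I z = peak I z'"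
  unfolding peak_def by (metis image_cong)

lemma peak_eq_MAX:
  assumes "finite I" "I \<noteq> {}"
  shows "peak I (\<lambda>i. real (l i)) = real (MAX i\<in>I. l i)"
proof (rule antisym)
  show "peak I (\<lambda>i. real (l i)) \<le> real (MAX i\<in>I. l i)"
    using assms by (auto simp: peak_le_iff)
  have "(MAX i\<in>I. l i) \<in> l ` I"
    using assms by (intro Max_in) auto
  then obtain i where "i \<in> I" "(MAX i\<in>I. l i) = l i"
    by auto
  then show "real (MAX i\<in>I. l i) \<le> peak I (\<lambda>i. real (l i))"
    using peak_ge[OF assms(1), of i "\<lambda>i. real (l i)"] by simp
qed

lemma static_value_nonneg:
  assumes "finite I" "\<And>i. i \<in> I \<Longrightarrow> 0 \<le> p i" "(\<Sum>i\<in>I. p i) \<le> 1"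
  shows "0 \<le> static_value p I t z"
  using assms
proof (induction t arbitrary: z)
  case 0
  then show ?case by (simp add: peak_nonneg)
next
  case (Suc t)
  then show ?case by (auto intro!: add_nonneg_nonneg mult_nonneg_nonneg sum_nonneg)
qed

lemma static_value_mono:
  assumes "finite I" "\<And>i. i \<in> I \<Longrightarrow> 0 \<le> p i" "(\<Sum>i\<in>I. p i) \<le> 1"
    and "\<And>i. i \<in> I \<Longrightarrow> z i \<le> z' i"
  shows "static_value p I t z \<le> static_value p I t z'"
  using assms(4)
proof (induction t arbitrary: z z')
  case 0
  have "z i \<le> peak I z'" if "i \<in> I" for i
    using peak_ge[OF assms(1) that, of z'] 0[OF that] by simp
  then show ?case
    using assms(1) by (simp add: peak_le_iff peak_nonneg)
next
  case (Suc t)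
  have "static_value p I t (z(i := z i + 1)) \<le> static_value p I t (z'(i := z' i + 1))"
    if "i \<in> I" for i
    using Suc.prems that by (intro Suc.IH) auto
  then show ?case
    using assms Suc by (auto intro!: add_mono mult_left_mono sum_mono)
qed

text \<open>The peak is convex in the loads, and every step of the recursion is a convex combination of
  values at translated loads.\<close>

lemma static_value_convex:
  assumes "finite I" "\<And>i. i \<in> I \<Longrightarrow> 0 \<le> p i" "(\<Sum>i\<in>I. p i) \<le> 1"
    and "0 \<le> a" "a \<le> 1"
  shows "static_value p I t (\<lambda>k. (1 - a) * z k + a * z' k)
    \<le> (1 - a) * static_value p I t z + a * static_value p I t z'"
proof (induction t arbitrary: z z')
  case 0
  have "(1 - a) * z i + a * z' i \<le> (1 - a) * peak I z + a * peak I z'" if "i \<in> I" for i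
    using peak_ge[OF assms(1) that] assms(4,5) by (intro add_mono mult_left_mono) auto
  then show ?case
    using assms by (simp add: peak_le_iff peak_nonneg)
next
  case (Suc t)
  let ?V = "static_value p I t" and ?u = "\<lambda>k. (1 - a) * z k + a * z' k"
  have upd: "?u(i := ?u i + 1)
      = (\<lambda>k. (1 - a) * (z(i := z i + 1)) k + a * (z'(i := z' i + 1)) k)" for i
    by (auto simp: algebra_simps)
  have "(1 - sum p I) * ?V ?u + (\<Sum>i\<in>I. p i * ?V (?u(i := ?u i + 1)))
      \<le> (1 - sum p I) * ((1 - a) * ?V z + a * ?V z')
        + (\<Sum>i\<in>I. p i * ((1 - a) * ?V (z(i := z i + 1)) + a * ?V (z'(i := z' i + 1))))"
    unfolding upd using assms by (intro add_mono mult_left_mono sum_mono Suc.IH) auto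
  also have "\<dots> = (1 - a) * static_value p I (Suc t) z + a * static_value p I (Suc t) z'"
    by (simp add: algebra_simps sum.distrib sum_subtractf sum_distrib_left)
  finally show ?case by simp
qed

text \<open>Keeping each sale only with probability \<open>a\<close> scales the load of the best product by \<open>a\<close> in
  expectation.  In recursive form: raising a load by the deterministic amount \<open>a\<close> is no better than
  raising it by \<open>1\<close> with probability \<open>a\<close>, by convexity.  The initial loads are scaled as well in
  order to keep the induction going; they are zero in the application.\<close>

lemma static_value_thinning:
  assumes "finite I" "\<And>i. i \<in> I \<Longrightarrow> 0 \<le> p i" "(\<Sum>i\<in>I. p i) \<le> 1"
    and "0 \<le> a" "a \<le> 1"
  shows "a * static_value p I t z \<le> static_value (\<lambda>i. a * p i) I t (\<lambda>k. a * z k)"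
proof (induction t arbitrary: z)
  case 0
  have "a * peak I z \<le> peak I (\<lambda>k. a * z k)"
  proof (cases "peak I z = 0")
    case True
    then show ?thesis using assms(1) by (simp add: peak_nonneg)
  next
    case False
    have "peak I z \<in> insert 0 (z ` I)"
      unfolding peak_def using assms(1) by (intro Max_in) auto
    then obtain i where "i \<in> I" "peak I z = z i"
      using False by auto
    then show ?thesis
      using peak_ge[OF assms(1), of i "\<lambda>k. a * z k"] by simp
  qed
  then show ?case by simp
next
  case (Suc t)
  let ?P = "static_value p I t" and ?Q = "static_value (\<lambda>i. a * p i) I t"
  let ?u = "\<lambda>k. a * z k"
  have sum_le: "(\<Sum>i\<in>I. a * p i) \<le> 1"
  proof -
    have "a * sum p I \<le> 1 * 1"
      using assms by (intro mult_mono sum_nonneg) auto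
    then show ?thesis by (simp add: sum_distrib_left)
  qed
  have move: "a * ?P (z(i := z i + 1)) \<le> (1 - a) * ?Q ?u + a * ?Q (?u(i := ?u i + 1))"
    if "i \<in> I" for i
  proof -
    have "a * ?P (z(i := z i + 1)) \<le> ?Q (\<lambda>k. a * (z(i := z i + 1)) k)"
      by (rule Suc.IH)
    also have "(\<lambda>k. a * (z(i := z i + 1)) k)
        = (\<lambda>k. (1 - a) * ?u k + a * (?u(i := ?u i + 1)) k)"
      by (auto simp: algebra_simps)
    also have "?Q \<dots> \<le> (1 - a) * ?Q ?u + a * ?Q (?u(i := ?u i + 1))"
      using assms sum_le by (intro static_value_convex) auto
    finally show ?thesis .
  qed
  have "a * static_value p I (Suc t) z
      = (1 - sum p I) * (a * ?P z) + (\<Sum>i\<in>I. p i * (a * ?P (z(i := z i + 1))))"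
    by (simp add: algebra_simps sum_distrib_left)
  also have "\<dots> \<le> (1 - sum p I) * ?Q ?u
      + (\<Sum>i\<in>I. p i * ((1 - a) * ?Q ?u + a * ?Q (?u(i := ?u i + 1))))"
    using assms Suc.IH move by (intro add_mono mult_left_mono sum_mono) auto
  also have "(\<Sum>i\<in>I. p i * ((1 - a) * ?Q ?u + a * ?Q (?u(i := ?u i + 1))))
      = sum p I * ((1 - a) * ?Q ?u) + (\<Sum>i\<in>I. a * p i * ?Q (?u(i := ?u i + 1)))"
    by (simp only: distrib_left sum.distrib flip: sum_distrib_right) (simp add: mult_ac)
  also have "(1 - sum p I) * ?Q ?u + \<dots> = static_value (\<lambda>i. a * p i) I (Suc t) ?u"
    by (simp add: algebra_simps flip: sum_distrib_left)
  finally show ?case .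
qed

section \<open>The static model and the dynamic program as recursive values\<close>

lemma load_Suc_update:
  "load (Suc T) (f(T := y)) i = load T f i + (if y = i then 1 else 0)"
proof -
  have "{t \<in> {..<Suc T}. (f(T := y)) t = i}
      = {t \<in> {..<T}. f t = i} \<union> (if y = i then {T} else {})"
    by (auto simp: less_Suc_eq)
  then show ?thesis
    unfolding load_def by (auto simp: card_insert_if)
qed

lemma total_weight_nonneg:
  "(\<And>i. i \<in> S \<Longrightarrow> v i > 0) \<Longrightarrow> total_weight v S \<ge> 0"
  unfolding total_weight_def by (intro sum_nonneg) (auto intro: less_imp_le)

lemma mnl_prob_nonneg:
  "(\<And>i. i \<in> S \<Longrightarrow> v i > 0) \<Longrightarrow> mnl_prob v S j \<ge> 0"
  using total_weight_nonneg[of S v] by (auto simp: mnl_prob_def less_imp_le)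

lemma mnl_prob_sum:
  assumes "0 \<notin> S" "\<And>i. i \<in> S \<Longrightarrow> v i > 0"
  shows "mnl_prob v S 0 = 1 - (\<Sum>i\<in>S. mnl_prob v S i)"
proof -
  have "(\<Sum>i\<in>S. mnl_prob v S i) = (\<Sum>i\<in>S. v i / (1 + total_weight v S))"
    using assms(1) by (intro sum.cong) (auto simp: mnl_prob_def)
  also have "\<dots> = total_weight v S / (1 + total_weight v S)"
    by (simp add: total_weight_def sum_divide_distrib)
  finally show ?thesis
    using total_weight_nonneg[of S v] assms(2) by (simp add: mnl_prob_def field_simps)
qed

text \<open>Conditioning on the last customer: its choice shifts the initial loads \<open>z\<close> of the process of
  the remaining ones, hence the generalisation from \<open>z = 0\<close>.\<close>

lemma static_value_mnl:
  assumes "finite S" "0 \<notin> S" "\<And>i. i \<in> S \<Longrightarrow> v i > 0"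
  shows "measure_pmf.expectation (static_choices v T S)
      (\<lambda>\<omega>. peak S (\<lambda>i. z i + real (load T \<omega> i))) = static_value (mnl_prob v S) S T z"
proof (induction T arbitrary: z)
  case 0
  show ?case by (simp add: static_choices_def load_def)
next
  case (Suc T)
  have supp: "set_pmf (mnl_pmf v S) \<subseteq> insert 0 S"
    by (auto simp: set_pmf_eq pmf_mnl_pmf[OF assms] mnl_prob_def)
  then have fin: "finite (set_pmf (mnl_pmf v S))"
    using assms(1) finite_subset by blast
  have "finite (set_pmf (static_choices v T S))"
    unfolding static_choices_def
    by (rule finite_subset[OF set_Pi_pmf_subset']) (auto intro!: finite_PiE_dflt fin)
  then have fin_T: "finite (set_pmf (map_pmf (\<lambda>f. f(T := y)) (static_choices v T S)))" for y
    by simp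
  have split: "static_choices v (Suc T) S =
      mnl_pmf v S \<bind> (\<lambda>y. map_pmf (\<lambda>f. f(T := y)) (static_choices v T S))"
    unfolding static_choices_def lessThan_Suc
    by (subst Pi_pmf_insert') (auto simp: map_pmf_def)
  have step: "peak S (\<lambda>i. z i + real (load (Suc T) (f(T := y)) i))
      = peak S (\<lambda>i. (if y = 0 then z else z(y := z y + 1)) i + real (load T f i))" for f y
    using assms(2) by (intro peak_cong) (auto simp: load_Suc_update intro: gr0I)
  have "measure_pmf.expectation (static_choices v (Suc T) S)
      (\<lambda>\<omega>. peak S (\<lambda>i. z i + real (load (Suc T) \<omega> i)))
      = (\<Sum>y\<in>insert 0 S. mnl_prob v S y *
          static_value (mnl_prob v S) S T (if y = 0 then z else z(y := z y + 1)))"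
    unfolding split
    by (subst pmf_expectation_bind[OF _ fin_T supp])
       (use assms in \<open>simp_all only: finite_insert pmf_mnl_pmf[OF assms] integral_map_pmf step Suc.IH
          real_scaleR_def\<close>)
  also have "\<dots> = static_value (mnl_prob v S) S (Suc T) z"
  proof -
    have "(\<Sum>y\<in>S. mnl_prob v S y *
          static_value (mnl_prob v S) S T (if y = 0 then z else z(y := z y + 1)))
        = (\<Sum>y\<in>S. mnl_prob v S y * static_value (mnl_prob v S) S T (z(y := z y + 1)))"
      using assms(2) by (intro sum.cong) auto
    then show ?thesis
      using assms by (simp add: mnl_prob_sum[of S v])
  qed
  finally show ?case .
qed

lemma expected_max_load_eq_static_value:
  assumes "finite S" "S \<noteq> {}" "0 \<notin> S" "\<And>i. i \<in> S \<Longrightarrow> v i > 0"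
  shows "expected_max_load v T S = static_value (mnl_prob v S) S T (\<lambda>_. 0)"
  using static_value_mnl[of S v T "\<lambda>_. 0"] assms peak_eq_MAX[of S]
  by (simp add: expected_max_load_def max_load_def)

lemma adaptive_value_le:
  assumes "\<And>S. S \<subseteq> {1..n} \<Longrightarrow>
     adaptive_value v n g t l * mnl_prob v S 0
        + (\<Sum>i\<in>S. adaptive_value v n g t (l(i := l i + 1)) * mnl_prob v S i) \<le> b"
  shows "adaptive_value v n g (Suc t) l \<le> b"
  using assms by (auto intro!: Max.boundedI)

lemma adaptive_value_ge:
  assumes "S \<subseteq> {1..n}"
  shows "adaptive_value v n g t l * mnl_prob v S 0
        + (\<Sum>i\<in>S. adaptive_value v n g t (l(i := l i + 1)) * mnl_prob v S i)
        \<le> adaptive_value v n g (Suc t) l"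
  using assms by (auto intro!: Max_ge)

lemma dp_value_eq_adaptive_value:
  assumes "n \<ge> 1"
  shows "dp_value v n t l = adaptive_value v n (\<lambda>l. peak {1..n} (\<lambda>i. real (l i))) t l"
  using assms by (induction t arbitrary: l) (simp_all add: peak_eq_MAX)

text \<open>Each summand of the reward may be collected by a policy of its own.\<close>

lemma adaptive_value_subadditive:
  assumes "\<And>l. g l \<le> g1 l + g2 l" "\<And>i. i \<in> {1..n} \<Longrightarrow> v i > 0"
  shows "adaptive_value v n g t l \<le> adaptive_value v n g1 t l + adaptive_value v n g2 t l"
proof (induction t arbitrary: l)
  case 0
  show ?case using assms(1) by simp
next
  case (Suc t)
  let ?a = "\<lambda>h. adaptive_value v n h t" and ?u = "\<lambda>i. l(i := l i + 1)"
  show ?case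
  proof (rule adaptive_value_le)
    fix S assume S: "S \<subseteq> {1..n}"
    then have nn: "mnl_prob v S j \<ge> 0" for j
      using assms(2) by (intro mnl_prob_nonneg) auto
    have "?a g l * mnl_prob v S 0 + (\<Sum>i\<in>S. ?a g (?u i) * mnl_prob v S i)
      \<le> (?a g1 l + ?a g2 l) * mnl_prob v S 0
        + (\<Sum>i\<in>S. (?a g1 (?u i) + ?a g2 (?u i)) * mnl_prob v S i)"
      using nn by (intro add_mono mult_right_mono sum_mono Suc.IH) auto
    also have "\<dots> = (?a g1 l * mnl_prob v S 0 + (\<Sum>i\<in>S. ?a g1 (?u i) * mnl_prob v S i))
        + (?a g2 l * mnl_prob v S 0 + (\<Sum>i\<in>S. ?a g2 (?u i) * mnl_prob v S i))"
      by (simp add: algebra_simps sum.distrib)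
    also have "\<dots> \<le> adaptive_value v n g1 (Suc t) l + adaptive_value v n g2 (Suc t) l"
      by (intro add_mono adaptive_value_ge S)
    finally show "?a g l * mnl_prob v S 0 + (\<Sum>i\<in>S. ?a g (?u i) * mnl_prob v S i) \<le> \<dots>" .
  qed
qed

section \<open>Products whose probability caps sum to at most one\<close>

lemma real_load_update:
  "(\<lambda>k. real ((l(i := l i + 1)) k)) = (\<lambda>k. real (l k))(i := real (l i) + 1)"
  by auto

lemma static_value_cong:
  assumes "\<And>i. i \<in> I \<Longrightarrow> z i = z' i"
  shows "static_value p I t z = static_value p I t z'"
  using assms
proof (induction t arbitrary: z z')
  case 0
  then show ?case by (auto intro: peak_cong)
next
  case (Suc t)
  have "static_value p I t (z(i := z i + 1)) = static_value p I t (z'(i := z' i + 1))"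
    if "i \<in> I" for i
    using Suc.prems that by (intro Suc.IH) auto
  moreover have "static_value p I t z = static_value p I t z'"
    using Suc.prems by (rule Suc.IH)
  ultimately show ?case
    by simp
qed

text \<open>Raising a load never lowers the static value, so the policy can only lose by choosing a product
  of \<open>A\<close> with a probability below its cap \<open>p i\<close>; a choice outside \<open>A\<close> leaves that value unchanged.\<close>

lemma adaptive_value_le_static_value_pointwise:
  assumes v: "\<And>i. i \<in> {1..n} \<Longrightarrow> v i > 0"
    and A: "A \<subseteq> {1..n}" and p: "(\<Sum>i\<in>A. p i) \<le> 1"
    and cap: "\<And>S i. S \<subseteq> {1..n} \<Longrightarrow> i \<in> A \<Longrightarrow> mnl_prob v S i \<le> p i"
  shows "adaptive_value v n (\<lambda>l. peak A (\<lambda>i. real (l i))) t l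
    \<le> static_value p A t (\<lambda>i. real (l i))"
proof (induction t arbitrary: l)
  case 0
  show ?case by simp
next
  case (Suc t)
  let ?a = "adaptive_value v n (\<lambda>l. peak A (\<lambda>i. real (l i))) t"
  let ?V = "static_value p A t" and ?z = "\<lambda>i. real (l i)"
  have fA: "finite A" using A finite_subset by blast
  have p0: "0 \<le> p i" if "i \<in> A" for i
    using cap[of "{}" i] that A by (auto simp: mnl_prob_def split: if_splits)
  show ?case
  proof (rule adaptive_value_le)
    fix S assume S: "S \<subseteq> {1..n}"
    then have nn: "mnl_prob v S j \<ge> 0" for j
      using v by (intro mnl_prob_nonneg) auto
    have P0: "mnl_prob v S 0 = 1 - (\<Sum>i\<in>S. mnl_prob v S i)"
      using S v by (intro mnl_prob_sum) auto
    have fS: "finite S" using S finite_subset by blast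
    let ?d = "\<lambda>i. ?V (?z(i := ?z i + 1)) - ?V ?z"
    have d0: "0 \<le> ?d i" if "i \<in> A" for i
      using static_value_mono[OF fA p0 p, of ?z "?z(i := ?z i + 1)" t] by simp
    have dA: "?d i = 0" if "i \<notin> A" for i
      using that by (auto intro!: static_value_cong)
    have hit: "?a (l(i := l i + 1)) \<le> ?V (?z(i := ?z i + 1))" for i
      using Suc.IH[of "l(i := l i + 1)"] unfolding real_load_update .
    have "(\<Sum>i\<in>S. ?d i * mnl_prob v S i) = (\<Sum>i\<in>S \<inter> A. ?d i * mnl_prob v S i)"
      using fS dA by (intro sum.mono_neutral_right) auto
    also have "\<dots> \<le> (\<Sum>i\<in>S \<inter> A. ?d i * p i)"
      using d0 cap S by (intro sum_mono mult_left_mono) auto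
    also have "\<dots> \<le> (\<Sum>i\<in>A. ?d i * p i)"
      using d0 p0 fA by (intro sum_mono2) auto
    finally have gain: "(\<Sum>i\<in>S. ?d i * mnl_prob v S i) \<le> (\<Sum>i\<in>A. ?d i * p i)" .
    have "?a l * mnl_prob v S 0 + (\<Sum>i\<in>S. ?a (l(i := l i + 1)) * mnl_prob v S i)
      \<le> ?V ?z * mnl_prob v S 0 + (\<Sum>i\<in>S. ?V (?z(i := ?z i + 1)) * mnl_prob v S i)"
      by (intro add_mono mult_right_mono sum_mono Suc.IH hit nn)
    also have "\<dots> = ?V ?z + (\<Sum>i\<in>S. ?d i * mnl_prob v S i)"
      unfolding P0 by (simp add: algebra_simps sum_subtractf flip: sum_distrib_right)
    also have "\<dots> \<le> ?V ?z + (\<Sum>i\<in>A. ?d i * p i)"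
      using gain by simp
    also have "\<dots> = static_value p A (Suc t) ?z"
      by (simp add: algebra_simps sum_subtractf sum_distrib_right)
    finally show "?a l * mnl_prob v S 0 + (\<Sum>i\<in>S. ?a (l(i := l i + 1)) * mnl_prob v S i) \<le> \<dots>" .
  qed
qed

section \<open>Many products under a uniform cap\<close>

text \<open>Layer-cake formula: \<open>h u\<close> is \<open>h 0\<close> plus the increments of \<open>h\<close> at the levels up to \<open>u\<close>.\<close>

lemma sum_by_layers:
  fixes h :: "nat \<Rightarrow> real"
  assumes "finite K" and N: "\<And>k. k \<in> K \<Longrightarrow> w k \<le> N"
  shows "(\<Sum>k\<in>K. r k * h (w k)) = (\<Sum>k\<in>K. r k) * h 0
      + (\<Sum>a<N. (h (Suc a) - h a) * (\<Sum>k | k \<in> K \<and> Suc a \<le> w k. r k))"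
proof -
  have layers: "h u = h 0 + (\<Sum>a<N. if Suc a \<le> u then h (Suc a) - h a else 0)" if "u \<le> N" for u
  proof -
    have "(\<Sum>a<N. if Suc a \<le> u then h (Suc a) - h a else 0) = (\<Sum>a<u. h (Suc a) - h a)"
      using that by (intro sum.mono_neutral_cong_right) auto
    then show ?thesis by (simp add: sum_lessThan_telescope)
  qed
  have "(\<Sum>k\<in>K. r k * h (w k)) = (\<Sum>k\<in>K. r k * h 0
      + (\<Sum>a<N. if Suc a \<le> w k then (h (Suc a) - h a) * r k else 0))"
  proof (intro sum.cong refl)
    fix k assume "k \<in> K"
    have "r k * h (w k) = r k * (h 0 + (\<Sum>a<N. if Suc a \<le> w k then h (Suc a) - h a else 0))"
      using layers[OF N[OF \<open>k \<in> K\<close>]] by simp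
    also have "\<dots> = r k * h 0 + (\<Sum>a<N. if Suc a \<le> w k then (h (Suc a) - h a) * r k else 0)"
      by (auto simp: distrib_left sum_distrib_left intro!: sum.cong)
    finally show "r k * h (w k) = \<dots>" .
  qed
  also have "\<dots> = (\<Sum>k\<in>K. r k) * h 0
      + (\<Sum>a<N. \<Sum>k\<in>K. if Suc a \<le> w k then (h (Suc a) - h a) * r k else 0)"
    by (subst sum.swap) (simp add: sum.distrib sum_distrib_right)
  also have "(\<Sum>a<N. \<Sum>k\<in>K. if Suc a \<le> w k then (h (Suc a) - h a) * r k else 0)
      = (\<Sum>a<N. (h (Suc a) - h a) * (\<Sum>k | k \<in> K \<and> Suc a \<le> w k. r k))"
    using assms(1) by (auto simp: sum.inter_filter sum_distrib_left intro!: sum.cong)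
  finally show ?thesis .
qed

text \<open>First-order stochastic dominance.  By the layer-cake formula the tail probabilities need to be
  compared only at the levels where \<open>h\<close> increases; that freedom is what the majorization argument
  below uses.\<close>

lemma sum_le_of_tail_dominance:
  fixes h :: "nat \<Rightarrow> real" and x :: "'a \<Rightarrow> nat" and y :: "'b \<Rightarrow> nat"
  assumes "finite I" "finite J" "mono h"
    and tot: "(\<Sum>i\<in>I. p i) = (\<Sum>j\<in>J. q j)"
    and tail: "\<And>a. h a \<noteq> h (Suc a) \<Longrightarrow>
      (\<Sum>i | i \<in> I \<and> Suc a \<le> x i. p i) \<le> (\<Sum>j | j \<in> J \<and> Suc a \<le> y j. q j)"
  shows "(\<Sum>i\<in>I. p i * h (x i)) \<le> (\<Sum>j\<in>J. q j * h (y j))"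
proof -
  obtain N where N: "\<And>i. i \<in> I \<Longrightarrow> x i \<le> N" "\<And>j. j \<in> J \<Longrightarrow> y j \<le> N"
    using finite_nat_set_iff_bounded_le[of "x ` I \<union> y ` J"] assms(1,2) by auto
  have layer: "(h (Suc a) - h a) * (\<Sum>i | i \<in> I \<and> Suc a \<le> x i. p i)
      \<le> (h (Suc a) - h a) * (\<Sum>j | j \<in> J \<and> Suc a \<le> y j. q j)" for a
    using tail[of a] monoD[OF assms(3), of a "Suc a"]
    by (cases "h a = h (Suc a)") (auto intro!: mult_left_mono)
  show ?thesis
    using sum_by_layers[where h = h and r = p and w = x and N = N, OF assms(1)]
      sum_by_layers[where h = h and r = q and w = y and N = N, OF assms(2)] N tot layer
    by (simp add: sum_mono)
qed

lemma excess_update: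
  fixes x :: "nat \<Rightarrow> nat"
  assumes "finite B"
  shows "(\<Sum>j\<in>B. (x(k := x k + 1)) j - a)
     = (\<Sum>j\<in>B. x j - a) + (if k \<in> B \<and> a \<le> x k then 1 else 0)"
proof (cases "k \<in> B")
  case True
  have "(\<Sum>j\<in>B - {k}. (x(k := x k + 1)) j - a) = (\<Sum>j\<in>B - {k}. x j - a)"
    by (intro sum.cong) auto
  then show ?thesis
    using sum.remove[OF assms True, of "\<lambda>j. (x(k := x k + 1)) j - a"]
      sum.remove[OF assms True, of "\<lambda>j. x j - a"] True by auto
next
  case False
  then show ?thesis by (auto intro!: sum.cong)
qed

text \<open>Turns a comparison of excesses at neighbouring thresholds into one of numbers of products.\<close>

lemma excess_Suc:
  fixes x :: "nat \<Rightarrow> nat"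
  assumes "finite B"
  shows "(\<Sum>j\<in>B. x j - a) = (\<Sum>j\<in>B. x j - Suc a) + card {j\<in>B. Suc a \<le> x j}"
proof -
  have "(\<Sum>j\<in>B. x j - a) = (\<Sum>j\<in>B. (x j - Suc a) + (if Suc a \<le> x j then 1 else 0))"
    by (intro sum.cong) auto
  also have "\<dots> = (\<Sum>j\<in>B. x j - Suc a) + card {j\<in>B. Suc a \<le> x j}"
    using assms by (simp add: sum.distrib sum.inter_filter[symmetric])
  finally show ?thesis .
qed

text \<open>
  The hypothesis \<open>maj\<close> says that the loads \<open>y\<close> on \<open>K\<close> weakly majorize the loads \<open>x\<close> on \<open>B\<close>,
  expressed through the total excess over each threshold \<open>a\<close>; at \<open>a = Max (y ` K)\<close> it yields the
  comparison of the peaks.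

  For the induction step, a sale at load \<open>u\<close> raises the excess over exactly the thresholds
  \<open>a \<le> u\<close>.  So \<open>maj\<close> can break only at a tight threshold \<open>a\<close>, one where both excesses are equal,
  when the policy sells at load at least \<open>a\<close> and the static process sells at a load below \<open>a\<close>.
  At a tight threshold \<open>a \<ge> 1\<close>, \<open>maj\<close> at \<open>a - 1\<close> says that \<open>B\<close> has at most as many products with
  load at least \<open>a\<close> as \<open>K\<close> has.  Each of the former is sold with probability at most \<open>c\<close> and each
  of the latter with probability at least \<open>c\<close>, so the static sale reaches \<open>a\<close> at least as often.
  Thus the sale levels, compared at tight thresholds only, are stochastically ordered.  Threshold
  \<open>0\<close> is safe because the static process always sells (\<open>sum q K = 1\<close>).
\<close>

lemma adaptive_value_le_static_value_majorized:
  assumes v: "\<And>i. i \<in> {1..n} \<Longrightarrow> v i > 0"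
    and B: "B \<subseteq> {1..n}" and K: "finite K" and c: "0 \<le> c"
    and cap: "\<And>S j. S \<subseteq> {1..n} \<Longrightarrow> j \<in> B \<Longrightarrow> mnl_prob v S j \<le> c"
    and q: "\<And>i. i \<in> K \<Longrightarrow> c \<le> q i" "(\<Sum>i\<in>K. q i) = 1"
    and maj: "\<And>a. (\<Sum>j\<in>B. x j - a) \<le> (\<Sum>i\<in>K. y i - a)"
  shows "adaptive_value v n (\<lambda>l. peak B (\<lambda>j. real (l j))) t x
    \<le> static_value q K t (\<lambda>i. real (y i))"
  using maj
proof (induction t arbitrary: x y)
  case 0
  have fB: "finite B" using B finite_subset by blast
  have "x j \<le> Max (insert 0 (y ` K))" (is "_ \<le> ?b") if "j \<in> B" for j
  proof -
    have "(\<Sum>i\<in>K. y i - ?b) = 0"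
      using K by simp
    then have "(\<Sum>j\<in>B. x j - ?b) = 0"
      using 0[of ?b] by simp
    then show ?thesis using fB that by simp
  qed
  moreover have "real (Max (insert 0 (y ` K))) \<le> peak K (\<lambda>i. real (y i))" 
  proof -
    have "Max (insert 0 (y ` K)) \<in> insert 0 (y ` K)"
      using K by (intro Max_in) auto
    then show ?thesis
      using peak_nonneg[OF K] peak_ge[OF K, of _ "\<lambda>i. real (y i)"] by (auto simp del: Max_insert)
  qed
  ultimately have "real (x j) \<le> peak K (\<lambda>i. real (y i))" if "j \<in> B" for j
    using that by (meson of_nat_le_iff order_trans)
  then show ?case
    using fB K by (simp add: peak_le_iff peak_nonneg)
next
  case (Suc t)
  let ?a = "adaptive_value v n (\<lambda>l. peak B (\<lambda>j. real (l j))) t"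
  let ?G = "\<lambda>i. static_value q K t (\<lambda>k. real ((y(i := y i + 1)) k))"
  have fB: "finite B" using B finite_subset by blast
  show ?case
  proof (rule adaptive_value_le)
    fix S assume S: "S \<subseteq> {1..n}"
    have fS: "finite S" using S finite_subset by blast
    have S0: "0 \<notin> S" and B0: "0 \<notin> B" using S B by auto
    have nn: "mnl_prob v S j \<ge> 0" for j
      using S v by (intro mnl_prob_nonneg) auto
    have P0: "mnl_prob v S 0 = 1 - (\<Sum>i\<in>S. mnl_prob v S i)"
      using S v by (intro mnl_prob_sum) auto
    define J where "J = insert 0 S"
    \<comment> \<open>Option \<open>0\<close> and products outside \<open>B\<close> leave all excesses unchanged; they get level \<open>0\<close>.\<close>
    define x' where "x' k = (if k = 0 then x else x(k := x k + 1))" for k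
    define lev where "lev k = (if k \<in> S \<inter> B then x k else 0)" for k
    define tight where
      "tight = {Suc a | a. (\<Sum>j\<in>B. x j - Suc a) = (\<Sum>i\<in>K. y i - Suc a)}"
    \<comment> \<open>\<open>below u\<close>: the options of the policy that keep \<open>maj\<close> when the static sale is at load \<open>u\<close>.
      The best continuation among them, \<open>h u\<close>, separates the two sides: it bounds the value of
      every option at its own level, and is bounded by the static value after a sale at load
      \<open>u\<close>.  It increases at tight thresholds only.\<close>
    define below where "below u = {k \<in> J. \<forall>b\<in>tight. b \<le> lev k \<longrightarrow> b \<le> u}" for u
    define h where "h u = Max ((\<lambda>k. ?a (x' k)) ` below u)" for u
    have fJ: "finite J" using fS by (simp add: J_def)
    have fb: "finite (below u)" for u
      using fJ by (simp add: below_def)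
    have lev0: "lev 0 = 0" using S0 by (simp add: lev_def)
    have tight0: "0 \<notin> tight" by (simp add: tight_def)
    have below0: "0 \<in> below u" for u
      using tight0 by (auto simp: below_def J_def lev0)
    have mono_h: "mono h"
    proof (rule monoI)
      fix u u' :: nat assume "u \<le> u'"
      then have "below u \<subseteq> below u'"
        by (force simp: below_def)
      then show "h u \<le> h u'"
        unfolding h_def using below0 fb by (intro Max_mono) auto
    qed
    have f_le_h: "?a (x' k) \<le> h (lev k)" if "k \<in> J" for k
      unfolding h_def using that fb by (intro Max_ge) (auto simp: below_def)
    have h_le_G: "h (y i) \<le> ?G i" if "i \<in> K" for i
    proof -
      have "?a (x' k) \<le> ?G i" if k: "k \<in> below (y i)" for k
      proof (rule Suc.IH)
        fix a
        have *: "(\<Sum>j\<in>B. x' k j - a)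
            = (\<Sum>j\<in>B. x j - a) + (if k \<in> B \<and> a \<le> x k then 1 else 0)"
          using excess_update[OF fB, of x k a] B0 by (auto simp: x'_def)
        have **: "(\<Sum>j\<in>K. (y(i := y i + 1)) j - a)
            = (\<Sum>j\<in>K. y j - a) + (if a \<le> y i then 1 else 0)"
          using excess_update[OF K, of y i a] \<open>i \<in> K\<close> by simp
        consider "a = 0" | "a \<in> tight" | "(\<Sum>j\<in>B. x j - a) \<noteq> (\<Sum>i\<in>K. y i - a)"
          unfolding tight_def by (cases a) auto
        then show "(\<Sum>j\<in>B. x' k j - a) \<le> (\<Sum>j\<in>K. (y(i := y i + 1)) j - a)"
        proof cases
          case 1
          then show ?thesis unfolding * ** using Suc.prems[of a] by auto
        next
          case 2
          then have "a \<le> y i" if "k \<in> B" "a \<le> x k"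
            using k that B0 by (auto simp: below_def lev_def J_def)
          then show ?thesis unfolding * ** using Suc.prems[of a] by auto
        next
          case 3
          then show ?thesis unfolding * ** using Suc.prems[of a] by auto
        qed
      qed
      then show ?thesis
        unfolding h_def using below0 fb by (intro Max.boundedI) auto
    qed
    have tail: "(\<Sum>k | k \<in> J \<and> Suc a \<le> lev k. mnl_prob v S k)
        \<le> (\<Sum>i | i \<in> K \<and> Suc a \<le> y i. q i)" if "h a \<noteq> h (Suc a)" for a
    proof -
      have "Suc a \<in> tight"
      proof (rule ccontr)
        assume "Suc a \<notin> tight"
        then have "b \<le> Suc a \<longleftrightarrow> b \<le> a" if "b \<in> tight" for b
          using that by (metis le_Suc_eq)
        then have "below (Suc a) = below a"
          by (auto simp: below_def)
        then show False using that by (simp add: h_def)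
      qed
      then have "(\<Sum>j\<in>B. x j - Suc a) = (\<Sum>i\<in>K. y i - Suc a)"
        by (auto simp: tight_def)
      then have card_le: "card {j\<in>B. Suc a \<le> x j} \<le> card {i\<in>K. Suc a \<le> y i}"
        using Suc.prems[of a] excess_Suc[OF fB, of x a] excess_Suc[OF K, of y a] by simp
      have "(\<Sum>k | k \<in> J \<and> Suc a \<le> lev k. mnl_prob v S k)
          \<le> (\<Sum>k | k \<in> B \<and> Suc a \<le> x k. mnl_prob v S k)"
        using fB nn by (intro sum_mono2) (auto simp: lev_def split: if_splits)
      also have "\<dots> \<le> (\<Sum>k | k \<in> B \<and> Suc a \<le> x k. c)"
        using cap S by (intro sum_mono) auto
      also have "\<dots> \<le> (\<Sum>i | i \<in> K \<and> Suc a \<le> y i. c)"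
        using card_le c by (simp add: mult_right_mono)
      also have "\<dots> \<le> (\<Sum>i | i \<in> K \<and> Suc a \<le> y i. q i)"
        using q by (intro sum_mono) auto
      finally show ?thesis .
    qed
    have "?a x * mnl_prob v S 0 + (\<Sum>k\<in>S. ?a (x(k := x k + 1)) * mnl_prob v S k)
        = (\<Sum>k\<in>J. mnl_prob v S k * ?a (x' k))"
    proof -
      have "(\<Sum>k\<in>S. ?a (x(k := x k + 1)) * mnl_prob v S k)
          = (\<Sum>k\<in>S. mnl_prob v S k * ?a (x' k))"
        using S0 by (intro sum.cong refl) (auto simp: x'_def)
      then show ?thesis
        using S0 fS by (simp add: J_def x'_def)
    qed
    also have "\<dots> \<le> (\<Sum>k\<in>J. mnl_prob v S k * h (lev k))"
      using f_le_h nn by (intro sum_mono mult_left_mono) auto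
    also have "\<dots> \<le> (\<Sum>i\<in>K. q i * h (y i))"
      using fJ K mono_h tail P0 S0 fS q(2)
      by (intro sum_le_of_tail_dominance) (auto simp: J_def)
    also have "\<dots> \<le> (\<Sum>i\<in>K. q i * ?G i)"
      using h_le_G q(1) c by (intro sum_mono mult_left_mono) force+
    also have "\<dots> = static_value q K (Suc t) (\<lambda>i. real (y i))"
      using q(2) by (simp add: real_load_update[simplified])
    finally show "?a x * mnl_prob v S 0 + (\<Sum>k\<in>S. ?a (x(k := x k + 1)) * mnl_prob v S k)
        \<le> static_value q K (Suc t) (\<lambda>i. real (y i))" .
  qed
qed

section \<open>The approximation guarantee\<close>

lemma static_value_prob_cong:
  assumes "\<And>i. i \<in> I \<Longrightarrow> p i = p' i"
  shows "static_value p I t z = static_value p' I t z"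
  using assms by (induction t arbitrary: z) (simp_all cong: sum.cong)

lemma static_value_le_twice_mnl:
  assumes "finite K" "\<And>i. i \<in> K \<Longrightarrow> 0 \<le> r i" "(\<Sum>i\<in>K. r i) \<le> 1"
    and a: "1 / 2 \<le> a" "a \<le> 1"
    and "\<And>i. i \<in> K \<Longrightarrow> mnl_prob v K i = a * r i"
  shows "static_value r K T (\<lambda>_. 0) \<le> 2 * static_value (mnl_prob v K) K T (\<lambda>_. 0)"
proof -
  have "1 / 2 * static_value r K T (\<lambda>_. 0) \<le> a * static_value r K T (\<lambda>_. 0)"
    using assms by (intro mult_right_mono static_value_nonneg) auto
  also have "\<dots> \<le> static_value (\<lambda>i. a * r i) K T (\<lambda>_. a * 0)"
    using assms by (intro static_value_thinning) auto
  also have "\<dots> = static_value (mnl_prob v K) K T (\<lambda>_. 0)"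
    unfolding mult_zero_right by (intro static_value_prob_cong) (simp add: assms(6))
  finally show ?thesis by simp
qed

lemma mnl_prob_le_singleton:
  assumes "finite S" "\<And>i. i \<in> S \<Longrightarrow> v i > 0" "j \<noteq> 0" "v j > 0"
  shows "mnl_prob v S j \<le> v j / (1 + v j)"
proof (cases "j \<in> S")
  case True
  then have "v j \<le> total_weight v S"
    unfolding total_weight_def using assms by (intro member_le_sum) (auto intro: less_imp_le)
  then show ?thesis
    using True assms(3,4) by (auto simp: mnl_prob_def intro!: divide_left_mono mult_pos_pos)
qed (use assms in \<open>simp add: mnl_prob_def\<close>)

theorem theorem4p1:
  fixes v :: "nat \<Rightarrow> real" and n T :: nat
  assumes "n \<ge> 1" and "T \<ge> 1"
    and "\<And>i. i \<in> {1..n} \<Longrightarrow> v i > 0"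
    and "\<And>i j. 1 \<le> i \<Longrightarrow> i \<le> j \<Longrightarrow> j \<le> n \<Longrightarrow> v i \<ge> v j"
  shows "OPT_WO v n T \<ge> 1 / 4 * OPT_DP v n T"
proof -
  note pos = assms(3) and anti = assms(4)
  define W where "W m = total_weight v {1..m}" for m
  define E where "E m = static_value (mnl_prob v {1..m}) {1..m} T (\<lambda>_. 0)" for m
  have E_le: "E m \<le> OPT_WO v n T" if "m \<in> {1..n}" for m
  proof -
    have "expected_max_load v T {1..m} = E m"
      unfolding E_def using that pos by (intro expected_max_load_eq_static_value) auto
    then show ?thesis
      unfolding OPT_WO_def using that by (metis Max_ge finite_atLeastAtMost finite_imageI imageI)
  qed
  have W_Suc: "W (Suc m) = W m + v (Suc m)" for m
    by (simp add: W_def total_weight_def)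
  have W_nonneg: "0 \<le> W m" if "m \<le> n" for m
    unfolding W_def using that pos by (intro total_weight_nonneg) auto
  have mnl: "mnl_prob v {1..m} i = v i / (1 + W m)" if "i \<in> {1..m}" for m i
    using that by (simp add: mnl_prob_def W_def)

  \<comment> \<open>Here \<open>m = 0\<close> is possible (if \<open>v 1 > 1\<close>) and so is \<open>m = n\<close>; then one group is empty.\<close>
  obtain m where m: "m \<le> n" "W m \<le> 1" and m_max: "m < n \<Longrightarrow> 1 < W (Suc m)"
  proof -
    define M where "M = {m. m \<le> n \<and> W m \<le> 1}"
    have M: "finite M" "0 \<in> M"
      by (auto simp: M_def W_def total_weight_def)
    then have "Max M \<in> M" by (intro Max_in) auto
    moreover have "1 < W (Suc (Max M))" if "Max M < n"
    proof (rule ccontr)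
      assume "\<not> 1 < W (Suc (Max M))"
      then have "Suc (Max M) \<in> M" using that by (auto simp: M_def)
      then have "Suc (Max M) \<le> Max M" using M by (intro Max_ge)
      then show False by simp
    qed
    ultimately show thesis by (intro that[of "Max M"]) (auto simp: M_def)
  qed

  let ?A = "{1..m}" and ?B = "{Suc m..n}"
  let ?top = "\<lambda>I l. peak I (\<lambda>i. real (l i))"
  have "0 \<le> E 1"
    unfolding E_def
  proof (rule static_value_nonneg)
    show "sum (mnl_prob v {1..1}) {1..1} \<le> 1"
      using mnl_prob_sum[of "{1..1}" v] mnl_prob_nonneg[of "{1..1}" v 0] assms(1) pos by auto
  qed (use assms(1) pos in \<open>auto intro!: mnl_prob_nonneg\<close>)
  then have opt0: "0 \<le> OPT_WO v n T"
    using E_le[of 1] assms(1) by simp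

  have "OPT_DP v n T = adaptive_value v n (?top {1..n}) T (\<lambda>_. 0)"
    unfolding OPT_DP_def by (rule dp_value_eq_adaptive_value[OF assms(1)])
  also have "\<dots> \<le> adaptive_value v n (?top ?A) T (\<lambda>_. 0) + adaptive_value v n (?top ?B) T (\<lambda>_. 0)"
  proof (rule adaptive_value_subadditive)
    fix l :: "nat \<Rightarrow> nat"
    have "real (l i) \<le> ?top ?A l + ?top ?B l" if "i \<in> {1..n}" for i
    proof (cases "i \<le> m")
      case True
      then show ?thesis
        using peak_ge[of ?A i "\<lambda>i. real (l i)"] peak_nonneg[of ?B "\<lambda>i. real (l i)"] that by auto
    next
      case False
      then show ?thesis
        using peak_ge[of ?B i "\<lambda>i. real (l i)"] peak_nonneg[of ?A "\<lambda>i. real (l i)"] that by auto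
    qed
    then show "?top {1..n} l \<le> ?top ?A l + ?top ?B l"
      by (simp add: peak_le_iff peak_nonneg)
  qed (use pos in auto)
  also have "adaptive_value v n (?top ?A) T (\<lambda>_. 0) \<le> 2 * OPT_WO v n T"
  proof (cases "m = 0")
    case True
    have "adaptive_value v n (?top ?A) T (\<lambda>_. 0) \<le> static_value v ?A T (\<lambda>i. real 0)"
      using pos True by (intro adaptive_value_le_static_value_pointwise) auto
    also have "\<dots> = 0"
      unfolding True by (induction T) (simp_all add: peak_def)
    finally show ?thesis using opt0 by simp
  next
    case False
    have "adaptive_value v n (?top ?A) T (\<lambda>_. 0) \<le> static_value v ?A T (\<lambda>i. real 0)"
    proof (rule adaptive_value_le_static_value_pointwise)
      fix S i assume S: "S \<subseteq> {1..n}" "i \<in> ?A"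
      then have "mnl_prob v S i \<le> v i / (1 + v i)"
        using m pos finite_subset[OF S(1)] by (intro mnl_prob_le_singleton) auto
      also have "\<dots> \<le> v i"
        using pos[of i] S m by (simp add: field_simps)
      finally show "mnl_prob v S i \<le> v i" .
    qed (use pos m in \<open>auto simp: W_def total_weight_def\<close>)
    also have "\<dots> \<le> 2 * E m"
      unfolding E_def of_nat_0
    proof (rule static_value_le_twice_mnl[where a = "1 / (1 + W m)"])
      show "1 / 2 \<le> 1 / (1 + W m)" "1 / (1 + W m) \<le> 1"
        using m W_nonneg[of m] by (auto simp: field_simps)
      show "sum v ?A \<le> 1" using m by (simp add: W_def total_weight_def)
    qed (use pos m mnl in \<open>auto intro!: less_imp_le\<close>)
    also have "E m \<le> OPT_WO v n T"
      using False m by (intro E_le) auto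
    finally show ?thesis by simp
  qed
  also have "adaptive_value v n (?top ?B) T (\<lambda>_. 0) \<le> 2 * OPT_WO v n T"
  proof (cases "m < n")
    case False
    have "adaptive_value v n (?top ?B) T (\<lambda>_. 0) \<le> static_value v ?B T (\<lambda>i. real 0)"
      using pos False by (intro adaptive_value_le_static_value_pointwise) auto
    also have "\<dots> = 0"
      using False by (induction T) (simp_all add: peak_def)
    finally show ?thesis using opt0 by simp
  next
    case True
    let ?K = "{1..Suc m}" and ?w = "v (Suc m)"
    let ?q = "\<lambda>i. v i / W (Suc m)"
    note W1 = m_max[OF True]
    have w: "0 < ?w" using pos True by simp
    have "adaptive_value v n (?top ?B) T (\<lambda>_. 0) \<le> static_value ?q ?K T (\<lambda>i. real 0)"
    proof (rule adaptive_value_le_static_value_majorized[where c = "?w / (1 + ?w)"])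
      fix S j assume S: "S \<subseteq> {1..n}" "j \<in> ?B"
      then have "mnl_prob v S j \<le> v j / (1 + v j)"
        using m pos finite_subset[OF S(1)] by (intro mnl_prob_le_singleton) auto
      also have "\<dots> \<le> ?w / (1 + ?w)"
        using pos[of j] w anti[of "Suc m" j] S by (simp add: field_simps)
      finally show "mnl_prob v S j \<le> ?w / (1 + ?w)" .
    next
      fix i assume i: "i \<in> ?K"
      \<comment> \<open>This is where \<open>W m \<le> 1\<close> enters, via \<open>W (Suc m) \<le> 1 + ?w\<close>.\<close>
      have "?w / (1 + ?w) \<le> ?w / W (Suc m)"
        using m W1 w W_Suc[of m] by (intro divide_left_mono mult_pos_pos) auto
      also have "\<dots> \<le> v i / W (Suc m)"
        using anti[of i "Suc m"] i True W1 by (intro divide_right_mono) auto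
      finally show "?w / (1 + ?w) \<le> v i / W (Suc m)" .
    next
      show "(\<Sum>i\<in>?K. v i / W (Suc m)) = 1"
        using W1 by (simp add: W_def total_weight_def flip: sum_divide_distrib)
    qed (use pos w in auto)
    also have "\<dots> \<le> 2 * E (Suc m)"
      unfolding E_def of_nat_0
    proof (rule static_value_le_twice_mnl[where a = "W (Suc m) / (1 + W (Suc m))"])
      show "1 / 2 \<le> W (Suc m) / (1 + W (Suc m))" "W (Suc m) / (1 + W (Suc m)) \<le> 1"
        using W1 by (auto simp: field_simps)
      show "(\<Sum>i\<in>?K. v i / W (Suc m)) \<le> 1"
        using W1 by (simp add: W_def total_weight_def flip: sum_divide_distrib)
      show "mnl_prob v ?K i = W (Suc m) / (1 + W (Suc m)) * (v i / W (Suc m))" if "i \<in> ?K" for i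
        using W1 mnl[OF that] by simp
      show "0 \<le> v i / W (Suc m)" if "i \<in> ?K" for i
        using W1 pos[of i] that True by auto
    qed auto
    also have "E (Suc m) \<le> OPT_WO v n T"
      using True by (intro E_le) auto
    finally show ?thesis by simp
  qed
  finally show ?thesis by simp
qed

end
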